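(* Let $q$ be a prime power, $n,m\ge 2$, and let $C\le\mathbb{F}_{q^m}^n$ be an $\mathbb{F}_{q^m}$-linear code of dimension $k\ge 1$ and minimum rank distance $d$. Then: (1) $\ell_j^{(1)}(C)=m_j(C)$ for all $j\in\{1,\dots,k\}$; (2) $\ell_1^{(i)}(C)=\lceil d/i\rceil$ for all $i\in\{1,\dots,n\}$; (3) $\ell_j^{(i)}(C)\le n$ for all $i\in\{1,\dots,n\}$, $j\in\{1,\dots,k\}$; (4) $\ell_j^{(i)}(C)<\ell_{j+1}^{(i)}(C)$ for all $i\in\{1,\dots,n\}$, $j\in\{1,\dots,k-1\}$; (5) $\ell_j^{(i+1)}(C)\le\ell_j^{(i)}(C)$ for all $i\in\{1,\dots,n-1\}$, $j\in\{1,\dots,k\}$; (6) $\ell_j^{(i)}(C)\le n-k+j$ for all $i\in\{1,\dots,n\}$, $j\in\{1,\dots,k\}$; (7) $\ell_j^{(i)}(C)\ge\lceil d/i\rceil+j-1$ for all $i\in\{1,\dots,n\}$, $j\in\{1,\dots,k\}$.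
   Context: The rank $\mathrm{rk}(v)$ of $v\in\mathbb{F}_{q^m}^n$ is the $\mathbb{F}_q$-dimension of the $\mathbb{F}_q$-span of its entries; the minimum distance of a nonzero code $C$ is $d=\min\{\mathrm{rk}(v):v\in C,\ v\ne 0\}$. All dimensions are over $\mathbb{F}_{q^m}$. For $i\in\{1,\dots,n\}$, $\mathscr{L}_i(n,m;q)$ is the set of $\mathbb{F}_{q^m}$-subspaces of $\mathbb{F}_{q^m}^n$ spanned by vectors of rank at most $i$ (including $\{0\}$). The $(i,j)$-th lattice-rank weight of $C$ is $\ell_j^{(i)}(C)=\min\{\dim X: X\in\mathscr{L}_i(n,m;q),\ \dim(C\cap X)\ge j\}$. The $j$-th generalized rank weight is $m_j(C)=\min\{\dim A: A\in\mathcal{A},\ \dim(A\cap C)\ge j\}$, where $\mathcal{A}$ is the set of $\mathbb{F}_{q^m}$-subspaces of $\mathbb{F}_{q^m}^n$ having a basis of vectors with all entries in $\mathbb{F}_q$. *)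

theory Defs
  imports "HOL-Analysis.Cartesian_Space"
    "HOL-Number_Theory.Prime_Powers"
begin

text \<open>
  The extension of finite fields \<open>F\<^sub>q \<subseteq> F\<^bsub>q^m\<^esub>\<close> is given by two finite field types \<open>'f\<close> and \<open>'a\<close>
  together with an embedding \<open>h\<close>; the subfield \<open>F\<^sub>q\<close> of \<open>F\<^bsub>q^m\<^esub>\<close> is \<open>range h\<close>, and \<open>'f\<close> acts on
  \<open>'a\<close> through \<open>h\<close>. Linear algebra over \<open>'a\<close> on \<open>'a ^ 'n\<close> is that of the library (\<open>vec\<close>).
\<close>

definition field_embedding :: "('f::field \<Rightarrow> 'a::field) \<Rightarrow> bool" where
  "field_embedding h \<longleftrightarrow>
     h 1 = 1 \<and> (\<forall>x y. h (x + y) = h x + h y) \<and> (\<forall>x y. h (x * y) = h x * h y)"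

definition subfield_scale :: "('f::field \<Rightarrow> 'a::field) \<Rightarrow> 'f \<Rightarrow> 'a \<Rightarrow> 'a" where
  "subfield_scale h c x = h c * x"

lemma vector_space_subfield_scale:
  assumes "field_embedding h"
  shows "vector_space (subfield_scale h)"
  using assms by unfold_locales (auto simp: field_embedding_def subfield_scale_def algebra_simps)

definition rk :: "('f::field \<Rightarrow> 'a::field) \<Rightarrow> 'a ^ 'n \<Rightarrow> nat" where
  "rk h v = vector_space.dim (subfield_scale h)
              (module.span (subfield_scale h) (range (\<lambda>s. v $ s)))"

text \<open>Below, all sets whose minimum is taken are finite, since \<open>'a\<close> is a finite field.\<close>

definition min_rank_distance ::
    "('f::{field,finite} \<Rightarrow> 'a::{field,finite}) \<Rightarrow> ('a ^ 'n) set \<Rightarrow> nat" where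
  "min_rank_distance h C = Min {rk h v |v. v \<in> C \<and> v \<noteq> 0}"

text \<open>The zero space belongs to the rank lattice as the span of the empty set.\<close>

definition rank_lattice ::
    "('f::{field,finite} \<Rightarrow> 'a::{field,finite}) \<Rightarrow> nat \<Rightarrow> ('a ^ 'n) set set" where
  "rank_lattice h i = {X. \<exists>S. (\<forall>v\<in>S. rk h v \<le> i) \<and> X = vec.span S}"

definition lattice_rank_weight ::
    "('f::{field,finite} \<Rightarrow> 'a::{field,finite}) \<Rightarrow> nat \<Rightarrow> nat \<Rightarrow> ('a ^ 'n) set \<Rightarrow> nat" where
  "lattice_rank_weight h i j C =
     Min {vec.dim X |X. X \<in> rank_lattice h i \<and> j \<le> vec.dim (C \<inter> X)}"

definition subfield_based_spaces ::
    "('f::{field,finite} \<Rightarrow> 'a::{field,finite}) \<Rightarrow> ('a ^ 'n) set set" where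
  "subfield_based_spaces h =
     {A. \<exists>B. vec.independent B \<and> vec.span B = A \<and> (\<forall>v\<in>B. \<forall>s. v $ s \<in> range h)}"

definition generalized_rank_weight ::
    "('f::{field,finite} \<Rightarrow> 'a::{field,finite}) \<Rightarrow> nat \<Rightarrow> ('a ^ 'n) set \<Rightarrow> nat" where
  "generalized_rank_weight h j C =
     Min {vec.dim A |A. A \<in> subfield_based_spaces h \<and> j \<le> vec.dim (A \<inter> C)}"

end

theory Submission
  imports Defs
begin

text \<open>
  A vector has rank at most \<open>t\<close> iff its entries lie in the \<open>F\<^sub>q\<close>-span of \<open>t\<close> field elements. Cutting
  such a spanning set into blocks of size \<open>i\<close> writes a vector of rank at most \<open>t i\<close> as a sum of \<open>t\<close>
  vectors of rank at most \<open>i\<close>, while any combination of \<open>t\<close> such vectors has rank at most \<open>t i\<close>;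
  this is (2). Vectors of rank at most \<open>1\<close> are multiples of vectors over \<open>F\<^sub>q\<close>, which gives (1).
  Removing one vector from a basis of low-rank vectors lowers the dimension of the intersection with
  \<open>C\<close> by at most one, which gives (4); the bounds (6) and (7) follow by telescoping (4) from
  \<open>j = k\<close> and \<open>j = 1\<close>.
\<close>

section \<open>Rank bounds through spanning sets of field elements\<close>

text \<open>This trades a dimension for a witness \<open>B\<close> that need not be independent or
  lie in the span of the entries, so witnesses can be scaled, united and cut up below. As
  \<open>'a\<close> is finite, so is \<open>B\<close>, and \<open>card B\<close> is its true
  size.\<close>

lemma rk_le_iff:
  fixes h :: "'f::field \<Rightarrow> 'a::{field,finite}"
  assumes "field_embedding h"
  shows "rk h v \<le> t \<longleftrightarrow>
    (\<exists>B. card B \<le> t \<and> (\<forall>s. v $ s \<in> module.span (subfield_scale h) B))"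
proof -
  interpret F: vector_space "subfield_scale h"
    by (rule vector_space_subfield_scale[OF assms])
  show ?thesis
  proof
    assume le: "rk h v \<le> t"
    obtain B where B: "F.span (range (($) v)) \<subseteq> F.span B"
        "card B = F.dim (F.span (range (($) v)))"
      using F.basis_exists by blast
    have "v $ s \<in> F.span B" for s
      using B(1) F.span_base[of "v $ s" "range (($) v)"] by blast
    then show "\<exists>B. card B \<le> t \<and> (\<forall>s. v $ s \<in> F.span B)"
      using le B(2) unfolding rk_def by (intro exI[of _ B]) simp
  next
    assume "\<exists>B. card B \<le> t \<and> (\<forall>s. v $ s \<in> F.span B)"
    then obtain B where B: "card B \<le> t" "\<forall>s. v $ s \<in> F.span B" by blast
    have "F.span (range (($) v)) \<subseteq> F.span B"
      using B(2) by (intro F.span_minimal F.subspace_span) auto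
    from F.dim_le_card[OF this] show "rk h v \<le> t"
      using B(1) unfolding rk_def by simp
  qed
qed

text \<open>Multiplication by \<open>c\<close> is linear over the subfield, so it carries a set
  spanning the entries of \<open>v\<close> to one spanning the entries of \<open>c *s v\<close>. For
  \<open>c = 0\<close> the rank may drop.\<close>

lemma rk_scale_le:
  fixes h :: "'f::field \<Rightarrow> 'a::{field,finite}"
  assumes "field_embedding h"
  shows "rk h (c *s v) \<le> rk h v"
proof -
  interpret F: vector_space "subfield_scale h"
    by (rule vector_space_subfield_scale[OF assms])
  interpret mult_c: Vector_Spaces.linear "subfield_scale h" "subfield_scale h" "(*) c"
    by unfold_locales (auto simp: subfield_scale_def algebra_simps)
  obtain B where B: "card B \<le> rk h v" "\<forall>s. v $ s \<in> F.span B"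
    using rk_le_iff[OF assms] by blast
  have "card ((*) c ` B) \<le> rk h v"
    using card_image_le[of B "(*) c"] B(1) by simp
  moreover have "(c *s v) $ s \<in> F.span ((*) c ` B)" for s
    using B(2) by (auto simp: mult_c.span_image)
  ultimately show ?thesis
    using rk_le_iff[OF assms] by blast
qed

lemma rk_add_le:
  fixes h :: "'f::field \<Rightarrow> 'a::{field,finite}"
  assumes "field_embedding h"
  shows "rk h (v + w) \<le> rk h v + rk h w"
proof -
  interpret F: vector_space "subfield_scale h"
    by (rule vector_space_subfield_scale[OF assms])
  obtain A where A: "card A \<le> rk h v" "\<forall>s. v $ s \<in> F.span A"
    using rk_le_iff[OF assms] by blast
  obtain B where B: "card B \<le> rk h w" "\<forall>s. w $ s \<in> F.span B"
    using rk_le_iff[OF assms] by blast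
  have "card (A \<union> B) \<le> rk h v + rk h w"
    using card_Un_le[of A B] A(1) B(1) by simp
  moreover have "(v + w) $ s \<in> F.span (A \<union> B)" for s
    using A(2) B(2) by (auto simp: F.span_Un)
  ultimately show ?thesis
    using rk_le_iff[OF assms] by blast
qed

lemma rk_zero:
  fixes h :: "'f::field \<Rightarrow> 'a::{field,finite}"
  assumes "field_embedding h"
  shows "rk h 0 = 0"
proof -
  interpret F: vector_space "subfield_scale h"
    by (rule vector_space_subfield_scale[OF assms])
  have "rk h 0 \<le> 0"
    unfolding rk_le_iff[OF assms] by (rule exI[of _ "{}"]) simp
  then show ?thesis by simp
qed

lemma rk_span_le:
  fixes h :: "'f::field \<Rightarrow> 'a::{field,finite}"
  assumes h: "field_embedding h"
    and S: "\<And>w. w \<in> S \<Longrightarrow> rk h w \<le> i"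
    and v: "v \<in> vec.span S"
  shows "rk h v \<le> card S * i"
proof -
  have fin: "finite T" for T :: "('a ^ 'n) set"
    by simp
  obtain u where u: "v = (\<Sum>w\<in>S. u w *s w)"
    using v unfolding vec.span_finite[OF fin] by blast
  \<comment> \<open>The coefficients \<open>u\<close> are fixed for all of \<open>S\<close>; the
    induction runs over the partial sums, to which subadditivity of the rank applies.\<close>
  have "rk h (\<Sum>w\<in>T. u w *s w) \<le> card T * i" if "T \<subseteq> S" for T
    using fin[of T] that
  proof (induction T rule: finite_induct)
    case empty
    then show ?case by (simp add: rk_zero[OF h])
  next
    case (insert x T)
    have "rk h (u x *s x) \<le> i"
      using insert.prems S[of x] rk_scale_le[OF h, of "u x" x] by simp
    moreover have "rk h (\<Sum>w\<in>T. u w *s w) \<le> card T * i"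
      using insert by simp
    ultimately show ?case
      using insert.hyps rk_add_le[OF h, of "u x *s x" "\<Sum>w\<in>T. u w *s w"] by simp
  qed
  then show ?thesis using u by blast
qed

lemma rk_decompose:
  fixes h :: "'f::field \<Rightarrow> 'a::{field,finite}" and v :: "'a ^ 'n"
  assumes h: "field_embedding h" and "rk h v \<le> t * i"
  shows "\<exists>S. card S \<le> t \<and> (\<forall>w\<in>S. rk h w \<le> i) \<and> v \<in> vec.span S"
proof -
  interpret F: vector_space "subfield_scale h"
    by (rule vector_space_subfield_scale[OF h])
  obtain B where "card B \<le> t * i" "\<forall>s. v $ s \<in> F.span B"
    using assms rk_le_iff[OF h] by blast
  \<comment> \<open>The induction carries the spanning set \<open>B\<close> instead of the rank:
    what remains after one block is a new vector with a smaller, explicitly known spanning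
    set.\<close>
  then show ?thesis
  proof (induction t arbitrary: B v)
    case 0
    then have "v = 0"
      by (auto simp: vec_eq_iff)
    then show ?case
      by (intro exI[of _ "{}"]) simp
  next
    case (Suc t)
    \<comment> \<open>One block of \<open>i\<close> elements, or all of \<open>B\<close> if fewer
      are left; in both cases at most \<open>t * i\<close> elements remain.\<close>
    obtain B1 where B1: "B1 \<subseteq> B" "card B1 = min i (card B)"
      using obtain_subset_with_card_n[of "min i (card B)" B] by auto
    have "card (B - B1) \<le> t * i"
      using B1 Suc.prems(1) by (simp add: card_Diff_subset)
    moreover have "\<exists>x y. v $ s = x + y \<and> x \<in> F.span B1 \<and> y \<in> F.span (B - B1)" for s
    proof -
      have "v $ s \<in> F.span (B1 \<union> (B - B1))"
        using Suc.prems(2) B1(1) by (simp add: Un_absorb1)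
      then show ?thesis
        unfolding F.span_Un by blast
    qed
    \<comment> \<open>Splitting every entry along the two blocks gives two vectors: \<open>x\<close>
      has rank at most \<open>i\<close>, and \<open>y\<close> goes to the induction
      hypothesis.\<close>
    then obtain x y where xy: "\<And>s. v $ s = x s + y s" "\<And>s. x s \<in> F.span B1"
        "\<And>s. y s \<in> F.span (B - B1)"
      by metis
    ultimately obtain S where S: "card S \<le> t" "\<forall>w\<in>S. rk h w \<le> i" "vec_lambda y \<in> vec.span S"
      using Suc.IH[of "B - B1" "vec_lambda y"] by auto
    have "rk h (vec_lambda x) \<le> i"
      unfolding rk_le_iff[OF h] using xy(2) B1(2) by (intro exI[of _ B1]) simp
    moreover have "v = vec_lambda x + vec_lambda y"
      using xy(1) by (simp add: vec_eq_iff)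
    moreover have "vec_lambda x + vec_lambda y \<in> vec.span (insert (vec_lambda x) S)"
      using S(3) vec.span_mono[of S "insert (vec_lambda x) S"]
      by (intro vec.span_add) (auto intro: vec.span_base)
    moreover have "card (insert (vec_lambda x) S) \<le> Suc t"
      using S(1) by (simp add: card_insert_if)
    ultimately show ?case
      using S(2) by (intro exI[of _ "insert (vec_lambda x) S"]) auto
  qed
qed

section \<open>Vectors of rank at most one and spaces based on the subfield\<close>

lemma field_embedding_zero:
  assumes "field_embedding h"
  shows "h 0 = 0"
proof -
  have "h 0 + h 0 = h 0 + 0"
    using assms unfolding field_embedding_def by (metis add_0_right)
  then show ?thesis by (rule add_left_imp_eq)
qed

lemma rk_le_1_if_subfield_entries:
  fixes h :: "'f::field \<Rightarrow> 'a::{field,finite}"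
  assumes h: "field_embedding h" and v: "\<And>s. v $ s \<in> range h"
  shows "rk h v \<le> 1"
proof -
  interpret F: vector_space "subfield_scale h"
    by (rule vector_space_subfield_scale[OF h])
  have "v $ s \<in> F.span {1}" for s
    using v[of s] by (auto simp: F.span_singleton subfield_scale_def)
  then show ?thesis
    unfolding rk_le_iff[OF h] by (intro exI[of _ "{1}"]) simp
qed

text \<open>All entries are subfield multiples of a single element \<open>e\<close>, so
  \<open>v = e *s w\<close> with \<open>w\<close> over the subfield. Equality of spans is the form
  needed to exchange generators, and it includes \<open>v = 0\<close>.\<close>

lemma rk_le_1_obtain_subfield_vector:
  fixes h :: "'f::field \<Rightarrow> 'a::{field,finite}" and v :: "'a ^ 'n"
  assumes h: "field_embedding h" and v: "rk h v \<le> 1"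
  shows "\<exists>w. (\<forall>s. w $ s \<in> range h) \<and> vec.span {w} = vec.span {v}"
proof -
  interpret F: vector_space "subfield_scale h"
    by (rule vector_space_subfield_scale[OF h])
  have zero: "0 \<in> range h"
    using field_embedding_zero[OF h] by (metis rangeI)
  obtain B where B: "card B \<le> 1" "\<forall>s. v $ s \<in> F.span B"
    using v rk_le_iff[OF h] by blast
  \<comment> \<open>Inclusion suffices: if \<open>B\<close> is empty, any \<open>e\<close>
    serves.\<close>
  obtain e where "B \<subseteq> {e}"
  proof (cases "B = {}")
    case False
    then obtain e where "B = {e}"
      using B(1) by (metis card_1_singletonE card_0_eq finite le_antisym less_one not_le)
    then show ?thesis using that by blast
  qed simp
  then have "\<forall>s. \<exists>c. v $ s = h c * e"
    using B(2) F.span_mono[of B "{e}"] unfolding F.span_singleton subfield_scale_def by blast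
  then obtain c where c: "\<And>s. v $ s = h (c s) * e"
    by metis
  define w :: "'a ^ 'n" where "w = (\<chi> s. h (c s))"
  have vw: "v = e *s w"
    using c by (simp add: w_def vec_eq_iff mult.commute)
  show ?thesis
  \<comment> \<open>If \<open>e = 0\<close>, the chosen coefficients are arbitrary and may give a
    nonzero vector, so the witness is the zero vector instead.\<close>
  proof (cases "e = 0")
    case True
    then show ?thesis
      using zero vw by (intro exI[of _ 0]) simp
  next
    case False
    then have "vec.span {w} = vec.span {v}"
      unfolding vw using vec.span_image_scale[of "{w}" "\<lambda>_. e"] by simp
    then show ?thesis
      by (intro exI[of _ w]) (simp add: w_def)
  qed
qed

text \<open>With this, both weights in (1) are minima over the same spaces.\<close>

lemma rank_lattice_1_eq_subfield_based_spaces: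
  fixes h :: "'f::{field,finite} \<Rightarrow> 'a::{field,finite}"
  assumes h: "field_embedding h"
  shows "(rank_lattice h 1 :: ('a ^ 'n) set set) = subfield_based_spaces h"
proof (intro equalityI subsetI)
  fix X :: "('a ^ 'n) set"
  assume "X \<in> rank_lattice h 1"
  then obtain S where S: "\<forall>v\<in>S. rk h v \<le> 1" "X = vec.span S"
    unfolding rank_lattice_def by blast
  obtain g where g: "\<And>v. v \<in> S \<Longrightarrow> (\<forall>s. g v $ s \<in> range h) \<and> vec.span {g v} = vec.span {v}"
    using rk_le_1_obtain_subfield_vector[OF h] S(1) by metis
  have "g v \<in> vec.span S" if "v \<in> S" for v
    using g[OF that] vec.span_base[of "g v" "{g v}"] vec.span_mono[of "{v}" S] that by auto
  moreover have "v \<in> vec.span (g ` S)" if "v \<in> S" for v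
    using g[OF that] vec.span_base[of v "{v}"] vec.span_mono[of "{g v}" "g ` S"] that by auto
  ultimately have span: "vec.span (g ` S) = X"
    unfolding S(2) vec.span_eq by blast
  \<comment> \<open>The basis is chosen among the exchanged generators, so its vectors keep their
    entries in the subfield.\<close>
  obtain B where B: "B \<subseteq> g ` S" "vec.independent B" "g ` S \<subseteq> vec.span B"
    using vec.maximal_independent_subset[of "g ` S"] by blast
  have "vec.span B = X"
    using B span vec.span_eq[of B "g ` S"] vec.span_superset[of "g ` S"] by blast
  moreover have "\<forall>v\<in>B. \<forall>s. v $ s \<in> range h"
    using B(1) g by blast
  ultimately show "X \<in> subfield_based_spaces h"
    unfolding subfield_based_spaces_def using B(2) by blast
next
  fix X :: "('a ^ 'n) set"
  assume "X \<in> subfield_based_spaces h"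
  then obtain B where B: "vec.span B = X" "\<forall>v\<in>B. \<forall>s. v $ s \<in> range h"
    unfolding subfield_based_spaces_def by blast
  have "\<forall>v\<in>B. rk h v \<le> 1"
    using B(2) by (intro ballI rk_le_1_if_subfield_entries[OF h]) blast
  then show "X \<in> rank_lattice h 1"
    unfolding rank_lattice_def using B(1) by blast
qed

section \<open>Rank lattices and the attainment of the minimum\<close>

lemma rank_lattice_mono: "i \<le> i' \<Longrightarrow> rank_lattice h i \<subseteq> rank_lattice h i'"
  unfolding rank_lattice_def by (blast intro: order_trans)

text \<open>The unit vectors have entries 0 and 1, hence rank at most one. The whole space makes the
  minimum in the weight one over a nonempty set and yields (3).\<close>

lemma UNIV_in_rank_lattice:
  assumes "field_embedding h" and "1 \<le> i"
  shows "UNIV \<in> rank_lattice h i"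
proof -
  have "0 \<in> range h" "1 \<in> range h"
    using field_embedding_zero[OF assms(1)] assms(1) unfolding field_embedding_def
    by (metis rangeI)+
  then have "axis r 1 $ s \<in> range h" for r s
    by (simp add: axis_def)
  then have "rk h (axis r 1) \<le> 1" for r
    by (intro rk_le_1_if_subfield_entries[OF assms(1)])
  then have "\<forall>v\<in>cart_basis. rk h v \<le> 1"
    unfolding cart_basis_def by blast
  then have "UNIV \<in> rank_lattice h 1"
    unfolding rank_lattice_def using span_cart_basis by blast
  then show ?thesis
    using rank_lattice_mono[OF assms(2)] by blast
qed

text \<open>A basis can be picked inside any spanning set of low-rank vectors, so the dimension
  counts vectors of rank at most \<open>i\<close>.\<close>

lemma rank_lattice_obtain_basis:
  assumes "X \<in> rank_lattice h i"
  obtains B where "vec.independent B" "\<forall>v\<in>B. rk h v \<le> i" "X = vec.span B" "card B = vec.dim X"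
proof -
  obtain S where S: "\<forall>v\<in>S. rk h v \<le> i" "X = vec.span S"
    using assms unfolding rank_lattice_def by blast
  obtain B where B: "B \<subseteq> S" "vec.independent B" "S \<subseteq> vec.span B"
    using vec.maximal_independent_subset[of S] by blast
  have "vec.span B = X"
    unfolding S(2) using B vec.span_eq[of B S] vec.span_superset[of S] by blast
  moreover have "vec.dim X = card B"
    using \<open>vec.span B = X\<close> B(2) vec.dim_span vec.dim_eq_card_independent by metis
  ultimately show ?thesis
    using that[of B] B S by auto
qed

lemma lattice_rank_weight_le:
  assumes "X \<in> rank_lattice h i" and "j \<le> vec.dim (C \<inter> X)"
  shows "lattice_rank_weight h i j C \<le> vec.dim X"
  unfolding lattice_rank_weight_def using assms by (intro Min_le) auto

lemma lattice_rank_weight_obtain: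
  assumes "field_embedding h" and "1 \<le> i" and "j \<le> vec.dim C"
  obtains X where "X \<in> rank_lattice h i" "j \<le> vec.dim (C \<inter> X)"
    "lattice_rank_weight h i j C = vec.dim X"
proof -
  have "lattice_rank_weight h i j C \<in> {vec.dim X |X. X \<in> rank_lattice h i \<and> j \<le> vec.dim (C \<inter> X)}"
    unfolding lattice_rank_weight_def
    using UNIV_in_rank_lattice[OF assms(1,2)] assms(3) by (intro Min_in) auto
  then show ?thesis using that by blast
qed

section \<open>Growth of the weights in \<open>j\<close> and their dependence on
  \<open>i\<close>\<close>

text \<open>The sum of \<open>C \<inter> X\<close> and \<open>Y\<close> stays inside
  \<open>X\<close>, and the two meet in \<open>C \<inter> Y\<close>; the dimension formula then
  bounds the loss by \<open>vec.dim X - vec.dim Y\<close>.\<close>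

lemma dim_Int_hyperplane:
  fixes C X Y :: "('a::field ^ 'n) set"
  assumes "vec.subspace C" "vec.subspace X" "vec.subspace Y" "Y \<subseteq> X" "vec.dim X \<le> vec.dim Y + 1"
  shows "vec.dim (C \<inter> X) \<le> vec.dim (C \<inter> Y) + 1"
proof -
  have "vec.dim {x + y |x y. x \<in> C \<inter> X \<and> y \<in> Y} + vec.dim (C \<inter> X \<inter> Y)
      = vec.dim (C \<inter> X) + vec.dim Y"
    using assms by (intro vec.dim_sums_Int vec.subspace_inter)
  moreover have "C \<inter> X \<inter> Y = C \<inter> Y"
    using assms(4) by blast
  moreover have "vec.dim {x + y |x y. x \<in> C \<inter> X \<and> y \<in> Y} \<le> vec.dim X"
    using assms(2,4) by (intro vec.dim_subset) (auto intro: vec.subspace_add)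
  ultimately show ?thesis
    using assms(5) by simp
qed

lemma lattice_rank_weight_less_Suc:
  assumes "field_embedding h" and "1 \<le> i" and C: "vec.subspace C" and "Suc j \<le> vec.dim C"
  shows "lattice_rank_weight h i j C < lattice_rank_weight h i (Suc j) C"
proof -
  obtain X where X: "X \<in> rank_lattice h i" "Suc j \<le> vec.dim (C \<inter> X)"
      "lattice_rank_weight h i (Suc j) C = vec.dim X"
    using lattice_rank_weight_obtain assms(1,2,4) by blast
  obtain B where B: "vec.independent B" "\<forall>v\<in>B. rk h v \<le> i" "X = vec.span B" "card B = vec.dim X"
    using rank_lattice_obtain_basis[OF X(1)] by blast
  have "vec.dim (C \<inter> X) \<le> vec.dim X"
    by (intro vec.dim_subset) simp
  \<comment> \<open>Since \<open>Suc j\<close> is positive, \<open>X\<close> is nonzero: there is a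
    basis vector to remove, and \<open>card B - 1\<close> is a genuine decrease.\<close>
  then have pos: "card B > 0"
    using X(2) B(4) by simp
  then obtain b where b: "b \<in> B"
    by fastforce
  define Y where "Y = vec.span (B - {b})"
  have dimY: "vec.dim Y = card B - 1"
    unfolding Y_def using vec.independent_mono[OF B(1), of "B - {b}"] b
    by (simp add: vec.dim_eq_card_independent vec.dim_span)
  have "vec.dim (C \<inter> X) \<le> vec.dim (C \<inter> Y) + 1"
    using dimY B(4) C vec.span_mono[of "B - {b}" B]
    by (intro dim_Int_hyperplane) (auto simp: Y_def B(3) simp del: vec.dim_span)
  moreover have "Y \<in> rank_lattice h i"
    unfolding rank_lattice_def Y_def using B(2) by blast
  ultimately have "lattice_rank_weight h i j C \<le> vec.dim Y"
    using X(2) by (intro lattice_rank_weight_le) auto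
  then show ?thesis
    using dimY pos X(3) B(4) by simp
qed

text \<open>The additive form avoids truncated subtraction of naturals.\<close>

lemma lattice_rank_weight_diff_le:
  assumes "field_embedding h" and "1 \<le> i" and "vec.subspace C" and "j + r \<le> vec.dim C"
  shows "lattice_rank_weight h i j C + r \<le> lattice_rank_weight h i (j + r) C"
  using assms(4)
proof (induction r)
  case (Suc r)
  then show ?case
    using lattice_rank_weight_less_Suc[OF assms(1-3), of "j + r"] by simp
qed simp

lemma lattice_rank_weight_Suc_rank_le:
  assumes "field_embedding h" and "1 \<le> i" and "j \<le> vec.dim C"
  shows "lattice_rank_weight h (Suc i) j C \<le> lattice_rank_weight h i j C"
proof -
  obtain X where "X \<in> rank_lattice h i" "j \<le> vec.dim (C \<inter> X)"
      "lattice_rank_weight h i j C = vec.dim X"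
    using lattice_rank_weight_obtain assms by blast
  then show ?thesis
    using lattice_rank_weight_le[of X h "Suc i" j C] rank_lattice_mono[of i "Suc i" h] by auto
qed

lemma lattice_rank_weight_le_dim:
  fixes h :: "'f::{field,finite} \<Rightarrow> 'a::{field,finite}" and C :: "('a ^ 'n) set"
  assumes "field_embedding h" and "1 \<le> i" and "j \<le> vec.dim C"
  shows "lattice_rank_weight h i j C \<le> CARD('n)"
  using lattice_rank_weight_le[OF UNIV_in_rank_lattice[OF assms(1,2)], of j C] assms(3)
    vec_dim_card[where 'a = 'a and 'n = 'n] by simp

section \<open>The minimum distance and the first weight\<close>

lemma min_rank_distance_le:
  assumes "v \<in> C" and "v \<noteq> 0"
  shows "min_rank_distance h C \<le> rk h v"
  unfolding min_rank_distance_def using assms by (intro Min_le) auto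

lemma min_rank_distance_obtain:
  assumes "1 \<le> vec.dim C"
  obtains v where "v \<in> C" "v \<noteq> 0" "rk h v = min_rank_distance h C"
proof -
  have "\<not> C \<subseteq> {0}"
    using assms unfolding vec.dim_eq_0[symmetric] by linarith
  then have "min_rank_distance h C \<in> {rk h v |v. v \<in> C \<and> v \<noteq> 0}"
    unfolding min_rank_distance_def by (intro Min_in) auto
  then show ?thesis using that by auto
qed

text \<open>This is (2) without division: for each \<open>t\<close>, a space of dimension at most
  \<open>t\<close> in the lattice meets \<open>C\<close> nontrivially iff some nonzero codeword has
  rank at most \<open>t * i\<close>.\<close>

lemma lattice_rank_weight_1_le_iff:
  assumes h: "field_embedding h" and i: "1 \<le> i" and C: "1 \<le> vec.dim C"
  shows "lattice_rank_weight h i 1 C \<le> t \<longleftrightarrow> min_rank_distance h C \<le> t * i"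
proof
  assume le: "lattice_rank_weight h i 1 C \<le> t"
  obtain X where X: "X \<in> rank_lattice h i" "1 \<le> vec.dim (C \<inter> X)"
      "lattice_rank_weight h i 1 C = vec.dim X"
    using lattice_rank_weight_obtain[OF h i C] by blast
  obtain B where B: "\<forall>v\<in>B. rk h v \<le> i" "X = vec.span B" "card B = vec.dim X"
    using rank_lattice_obtain_basis[OF X(1)] by blast
  have "\<not> C \<inter> X \<subseteq> {0}"
    using X(2) unfolding vec.dim_eq_0[symmetric] by linarith
  then obtain v where v: "v \<in> C" "v \<in> X" "v \<noteq> 0"
    by blast
  have "min_rank_distance h C \<le> rk h v"
    using v by (intro min_rank_distance_le)
  also have "\<dots> \<le> card B * i"
    using B v by (intro rk_span_le[OF h]) auto
  also have "\<dots> \<le> t * i"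
    using le B(3) X(3) by simp
  finally show "min_rank_distance h C \<le> t * i" .
next
  assume le: "min_rank_distance h C \<le> t * i"
  obtain v where v: "v \<in> C" "v \<noteq> 0" "rk h v = min_rank_distance h C"
    using min_rank_distance_obtain[OF C] by blast
  obtain S where S: "card S \<le> t" "\<forall>w\<in>S. rk h w \<le> i" "v \<in> vec.span S"
    using rk_decompose[OF h, of v t i] le v(3) by auto
  have "vec.dim (C \<inter> vec.span S) \<noteq> 0"
    using v S(3) vec.dim_eq_0[of "C \<inter> vec.span S"] by blast
  then have "lattice_rank_weight h i 1 C \<le> vec.dim (vec.span S)"
    using S(2) by (intro lattice_rank_weight_le) (auto simp: rank_lattice_def simp del: vec.dim_eq_0)
  \<comment> \<open>The summands in \<open>S\<close> may be dependent; only an upper bound on the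
    dimension is needed.\<close>
  also have "\<dots> \<le> card S"
    by (rule vec.dim_le_card) auto
  finally show "lattice_rank_weight h i 1 C \<le> t"
    using S(1) by simp
qed

text \<open>Both sides have the same natural upper bounds \<open>t\<close>, namely those with
  \<open>d \<le> t * i\<close> for the minimum distance \<open>d\<close>, so they agree.\<close>

lemma lattice_rank_weight_1_eq_ceiling:
  assumes "field_embedding h" and "1 \<le> i" and "1 \<le> vec.dim C"
  shows "int (lattice_rank_weight h i 1 C) = \<lceil>real (min_rank_distance h C) / real i\<rceil>"
proof -
  have iff: "\<lceil>real d / real i\<rceil> \<le> int t \<longleftrightarrow> d \<le> t * i" for d t
  proof -
    have "\<lceil>real d / real i\<rceil> \<le> int t \<longleftrightarrow> real d \<le> real (t * i)"
      using assms(2) by (simp add: ceiling_le_iff divide_le_eq)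
    then show ?thesis
      by (simp only: of_nat_le_iff)
  qed
  \<comment> \<open>The ceiling is nonnegative, so \<open>nat\<close> loses nothing.\<close>
  define c where "c = nat \<lceil>real (min_rank_distance h C) / real i\<rceil>"
  have c: "int c = \<lceil>real (min_rank_distance h C) / real i\<rceil>"
    unfolding c_def by (simp add: ceiling_mono[of 0, simplified])
  have "lattice_rank_weight h i 1 C \<le> t \<longleftrightarrow> c \<le> t" for t
    using lattice_rank_weight_1_le_iff[OF assms] iff[of "min_rank_distance h C" t]
    unfolding c[symmetric] by simp
  then show ?thesis
    using c by (metis order_antisym order_refl)
qed

theorem theorem6p6:
  fixes h :: "'f::{field,finite} \<Rightarrow> 'a::{field,finite}"
    and C :: "('a ^ 'n) set"
    and q m n k d :: nat
  assumes "primepow q"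
    and "n \<ge> 2" and "m \<ge> 2"
    and "CARD('f) = q" and "CARD('a) = q ^ m" and "CARD('n) = n"
    and "field_embedding h"
    and "vec.subspace C" and "vec.dim C = k" and "k \<ge> 1"
    and "min_rank_distance h C = d"
  shows "(\<forall>j\<in>{1..k}. lattice_rank_weight h 1 j C = generalized_rank_weight h j C)
    \<and> (\<forall>i\<in>{1..n}. int (lattice_rank_weight h i 1 C) = \<lceil>real d / real i\<rceil>)
    \<and> (\<forall>i\<in>{1..n}. \<forall>j\<in>{1..k}. lattice_rank_weight h i j C \<le> n)
    \<and> (\<forall>i\<in>{1..n}. \<forall>j\<in>{1..k - 1}. lattice_rank_weight h i j C < lattice_rank_weight h i (j + 1) C)
    \<and> (\<forall>i\<in>{1..n - 1}. \<forall>j\<in>{1..k}. lattice_rank_weight h (i + 1) j C \<le> lattice_rank_weight h i j C)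
    \<and> (\<forall>i\<in>{1..n}. \<forall>j\<in>{1..k}. int (lattice_rank_weight h i j C) \<le> int n - int k + int j)
    \<and> (\<forall>i\<in>{1..n}. \<forall>j\<in>{1..k}. int (lattice_rank_weight h i j C) \<ge> \<lceil>real d / real i\<rceil> + int j - 1)"
proof (intro conjI ballI)
  note h = \<open>field_embedding h\<close> and C = \<open>vec.subspace C\<close>
  have dim_C: "1 \<le> vec.dim C"
    using assms by simp
  show "lattice_rank_weight h 1 j C = generalized_rank_weight h j C" for j
    unfolding lattice_rank_weight_def generalized_rank_weight_def
      rank_lattice_1_eq_subfield_based_spaces[OF h] by (simp add: Int_commute)
  show weight_1: "int (lattice_rank_weight h i 1 C) = \<lceil>real d / real i\<rceil>" if "i \<in> {1..n}" for i
    using lattice_rank_weight_1_eq_ceiling[OF h _ dim_C] that assms by simp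
  show weight_le: "lattice_rank_weight h i j C \<le> n" if "i \<in> {1..n}" "j \<in> {1..k}" for i j
    using lattice_rank_weight_le_dim[OF h, of i j C] that assms by simp
  show "lattice_rank_weight h i j C < lattice_rank_weight h i (j + 1) C"
    if "i \<in> {1..n}" "j \<in> {1..k - 1}" for i j
  proof -
    have "Suc j \<le> vec.dim C"
      using that assms by auto
    then show ?thesis
      using lattice_rank_weight_less_Suc[OF h _ C, of i j] that by simp
  qed
  show "lattice_rank_weight h (i + 1) j C \<le> lattice_rank_weight h i j C"
    if "i \<in> {1..n - 1}" "j \<in> {1..k}" for i j
    using lattice_rank_weight_Suc_rank_le[OF h, of i j C] that assms by simp
  \<comment> \<open>The \<open>k - j\<close> strict increases from \<open>j\<close> to
    \<open>k\<close> must fit below the bound \<open>n\<close> on the weight at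
    \<open>k\<close>.\<close>
  show "int (lattice_rank_weight h i j C) \<le> int n - int k + int j"
    if "i \<in> {1..n}" "j \<in> {1..k}" for i j
    using lattice_rank_weight_diff_le[OF h _ C, of i j "k - j"] weight_le[of i k] that assms by simp
  \<comment> \<open>The \<open>j - 1\<close> strict increases from 1 to \<open>j\<close> add to the
    value of the first weight.\<close>
  show "int (lattice_rank_weight h i j C) \<ge> \<lceil>real d / real i\<rceil> + int j - 1"
    if "i \<in> {1..n}" "j \<in> {1..k}" for i j
    using lattice_rank_weight_diff_le[OF h _ C, of i 1 "j - 1"] weight_1[of i] that assms by simp
qed

end
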